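(* Let $p/q$ be an even rational parameter and $P=2p/(p+q)$. For every unit square $S$ of the integer grid, with center $c$, the set of good edges of $S$ (its grid light set) coincides with the set of edges of $S$ named by the letters in the label of the piece of the partition of $X_P$ containing $\Xi_P(c)$ (its tile light set).
   Context: Grid description. An even rational parameter is a rational $p/q\in(0,1)$, $p,q$ positive coprime integers, $pq$ even. Put $\omega=p+q$, $P=2p/\omega$, $Q=2q/\omega$. Line families: $\mathcal H$ = lines $y=n$, $\mathcal V$ = lines $x=n$ ($n\in\mathbb Z$), $\mathcal P$ = lines of slope $-P$ with integer $y$-intercept, $\mathcal Q$ = lines of slope $-Q$ with integer $y$-intercept. Functions mod $2\mathbb Z$, values represented in $(-1,1]$: $F_H=2Py$, $F_V=2Px$, $F_P=Py+P^2x+1$, $F_Q=Py+PQx+1$. A unit segment is an edge of a unit square of the integer grid; horizontal ones lie on $\mathcal H$-lines (set $A=H$), vertical ones on $\mathcal V$-lines (set $A=V$). A point $z$ of a unit segment $s$ is a light point of $s$ if for some $B\in\{P,Q\}$, $z$ lies on a line of $\mathcal B$, $F_A(z)F_B(z)>0$ and $|F_B(z)|<|F_A(z)|$. The light count of $s$ is the number of distinct light points of $s$, a light point that is the midpoint of a horizontal $s$ being counted twice; $s$ is good if its light count is $1$. The edges of a unit square are called N, S, E, W (north, south, east, west). Tile description. Let $\Lambda_P\subset\mathbb R^3$ be the lattice generated by $(2,P,P),(0,2,0),(0,0,2)$, $X_P=\mathbb R^3/\Lambda_P$ with coordinates $(T,U_1,U_2)$ and fundamental domain $[-1,1]^3$,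 and $\Xi_P(x,y)=(2Px+2y,2Px,2Px+2Py)\bmod\Lambda_P$. Each fiber $\{T\}\times[-1,1]^2$ ($T\in[-1,1]$) is partitioned as follows: given $u_1\le u_2\le u_3$, the lines $U_1=u_i$, $U_2=u_i$ ($i=1,2,3$) cut $[-1,1]^2$ into a $4\times4$ grid of rectangles, indexed by (column $a$, row $b$), $a,b\in\{1,..,4\}$, columns counted in increasing $U_1$ and rows in increasing $U_2$. Four of these are special, each labeled by one letter, with positions: for $T\in[-1,-1+P]$: $(u_1,u_2,u_3)=(T,1-P,2-P+T)$, W at $(4,4)$, N at $(1,3)$, E at $(2,2)$, S at $(3,1)$; for $T\in[-1+P,1-P]$: $(u_1,u_2,u_3)=(-1+P,T,1-P)$, N at $(1,4)$, E at $(3,3)$, W at $(2,2)$, S at $(4,1)$; for $T\in[1-P,1]$: $(u_1,u_2,u_3)=(-2+P+T,-1+P,T)$, N at $(2,4)$, W at $(3,3)$, S at $(4,2)$, E at $(1,1)$. Each non-special rectangle is labeled by the unordered pair $\{X,Y\}$ where $X$ is the letter of the special rectangle in its column and $Y$ that of the special rectangle in its row; special rectangles get the empty label. The pieces of the partition of $X_P$ are, for each of the seven labels, the union over all fibers of the rectangles with that label. For a tile center $c\in\{(m+\frac12,n+\frac12)\}$, the point $\Xi_P(c)$ (represented in $[-1,1]^3$) lies in the interior of a unique piece (this is known to hold for even rational parameters), so its label is well defined; the tile light set of the square centered at $c$ is the set of edges whose letters occur in that label (empty for the empty label). *)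

theory Defs
  imports "HOL-Analysis.Analysis"
begin

definition even_rat_param :: "nat \<Rightarrow> nat \<Rightarrow> bool" where
  "even_rat_param p q \<longleftrightarrow> 0 < p \<and> p < q \<and> coprime p q \<and> even (p * q)"

definition PP :: "nat \<Rightarrow> nat \<Rightarrow> real" where
  "PP p q = 2 * real p / real (p + q)"

definition QQ :: "nat \<Rightarrow> nat \<Rightarrow> real" where
  "QQ p q = 2 * real q / real (p + q)"

text \<open>Representative of r modulo 2Z in the interval (-1,1].\<close>
definition modrep :: "real \<Rightarrow> real" where
  "modrep r = r - 2 * of_int \<lceil>(r - 1) / 2\<rceil>"

datatype edge = North | South | East | West

definition FH :: "nat \<Rightarrow> nat \<Rightarrow> real \<times> real \<Rightarrow> real" where
  "FH p q z = modrep (2 * PP p q * snd z)"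

definition FV :: "nat \<Rightarrow> nat \<Rightarrow> real \<times> real \<Rightarrow> real" where
  "FV p q z = modrep (2 * PP p q * fst z)"

definition FP :: "nat \<Rightarrow> nat \<Rightarrow> real \<times> real \<Rightarrow> real" where
  "FP p q z = modrep (PP p q * snd z + (PP p q)\<^sup>2 * fst z + 1)"

definition FQ :: "nat \<Rightarrow> nat \<Rightarrow> real \<times> real \<Rightarrow> real" where
  "FQ p q z = modrep (PP p q * snd z + PP p q * QQ p q * fst z + 1)"

definition on_line :: "real \<Rightarrow> real \<times> real \<Rightarrow> bool" where
  "on_line s z \<longleftrightarrow> snd z + s * fst z \<in> \<int>"

definition is_horiz :: "edge \<Rightarrow> bool" where
  "is_horiz e \<longleftrightarrow> e = North \<or> e = South"

fun seg :: "int \<Rightarrow> int \<Rightarrow> edge \<Rightarrow> (real \<times> real) set" where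
  "seg m n North = {(x, of_int n + 1) | x. of_int m \<le> x \<and> x \<le> of_int m + 1}"
| "seg m n South = {(x, of_int n) | x. of_int m \<le> x \<and> x \<le> of_int m + 1}"
| "seg m n East = {(of_int m + 1, y) | y. of_int n \<le> y \<and> y \<le> of_int n + 1}"
| "seg m n West = {(of_int m, y) | y. of_int n \<le> y \<and> y \<le> of_int n + 1}"

fun seg_mid :: "int \<Rightarrow> int \<Rightarrow> edge \<Rightarrow> real \<times> real" where
  "seg_mid m n North = (of_int m + 1/2, of_int n + 1)"
| "seg_mid m n South = (of_int m + 1/2, of_int n)"
| "seg_mid m n East = (of_int m + 1, of_int n + 1/2)"
| "seg_mid m n West = (of_int m, of_int n + 1/2)"

definition FA :: "nat \<Rightarrow> nat \<Rightarrow> edge \<Rightarrow> real \<times> real \<Rightarrow> real" where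
  "FA p q e z = (if is_horiz e then FH p q z else FV p q z)"

definition light_point :: "nat \<Rightarrow> nat \<Rightarrow> int \<Rightarrow> int \<Rightarrow> edge \<Rightarrow> real \<times> real \<Rightarrow> bool" where
  "light_point p q m n e z \<longleftrightarrow> z \<in> seg m n e \<and>
     ((on_line (PP p q) z \<and> FA p q e z * FP p q z > 0 \<and> \<bar>FP p q z\<bar> < \<bar>FA p q e z\<bar>) \<or>
      (on_line (QQ p q) z \<and> FA p q e z * FQ p q z > 0 \<and> \<bar>FQ p q z\<bar> < \<bar>FA p q e z\<bar>))"

definition light_count :: "nat \<Rightarrow> nat \<Rightarrow> int \<Rightarrow> int \<Rightarrow> edge \<Rightarrow> nat" where
  "light_count p q m n e = card {z. light_point p q m n e z} +
     (if is_horiz e \<and> light_point p q m n e (seg_mid m n e) then 1 else 0)"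

definition good :: "nat \<Rightarrow> nat \<Rightarrow> int \<Rightarrow> int \<Rightarrow> edge \<Rightarrow> bool" where
  "good p q m n e \<longleftrightarrow> light_count p q m n e = 1"

definition grid_light_set :: "nat \<Rightarrow> nat \<Rightarrow> int \<Rightarrow> int \<Rightarrow> edge set" where
  "grid_light_set p q m n = {e. good p q m n e}"

definition cuts :: "real \<Rightarrow> real \<Rightarrow> nat \<Rightarrow> real list" where
  "cuts P T k = (if k = 1 then [-1, T, 1 - P, 2 - P + T, 1]
                 else if k = 2 then [-1, -1 + P, T, 1 - P, 1]
                 else [-1, -2 + P + T, -1 + P, T, 1])"

definition regime :: "real \<Rightarrow> real \<Rightarrow> nat \<Rightarrow> bool" where
  "regime P T k \<longleftrightarrow> (k = 1 \<and> -1 \<le> T \<and> T \<le> -1 + P) \<or>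
                      (k = 2 \<and> -1 + P \<le> T \<and> T \<le> 1 - P) \<or>
                      (k = 3 \<and> 1 - P \<le> T \<and> T \<le> 1)"

text \<open>Position (column, row) of the special rectangle of each letter.\<close>
definition spos :: "nat \<Rightarrow> edge \<Rightarrow> nat \<times> nat" where
  "spos k e = (if k = 1 then (case e of West \<Rightarrow> (4,4) | North \<Rightarrow> (1,3) | East \<Rightarrow> (2,2) | South \<Rightarrow> (3,1))
               else if k = 2 then (case e of North \<Rightarrow> (1,4) | East \<Rightarrow> (3,3) | West \<Rightarrow> (2,2) | South \<Rightarrow> (4,1))
               else (case e of North \<Rightarrow> (2,4) | West \<Rightarrow> (3,3) | South \<Rightarrow> (4,2) | East \<Rightarrow> (1,1)))"

definition rect_label :: "nat \<Rightarrow> nat \<Rightarrow> nat \<Rightarrow> edge set" where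
  "rect_label k a b = (if \<exists>X. spos k X = (a, b) then {}
                       else {X. fst (spos k X) = a \<or> snd (spos k X) = b})"

definition fund_piece :: "real \<Rightarrow> edge set \<Rightarrow> (real \<times> real \<times> real) set" where
  "fund_piece P L = {(T, U1, U2). \<exists>k. regime P T k \<and>
     (\<exists>a\<in>{1..4}. \<exists>b\<in>{1..4}.
        cuts P T k ! (a - 1) \<le> U1 \<and> U1 \<le> cuts P T k ! a \<and>
        cuts P T k ! (b - 1) \<le> U2 \<and> U2 \<le> cuts P T k ! b \<and>
        rect_label k a b = L)}"

text \<open>Preimage in R^3 of the piece of X_P = R^3 / Lambda_P, Lambda_P generated by
  (2,P,P), (0,2,0), (0,0,2).\<close>
definition piece :: "real \<Rightarrow> edge set \<Rightarrow> (real \<times> real \<times> real) set" where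
  "piece P L = {(T, U1, U2). \<exists>i j k :: int.
     (T - 2 * of_int i, U1 - (P * of_int i + 2 * of_int j), U2 - (P * of_int i + 2 * of_int k))
       \<in> fund_piece P L}"

definition Xi :: "real \<Rightarrow> real \<times> real \<Rightarrow> real \<times> real \<times> real" where
  "Xi P z = (2 * P * fst z + 2 * snd z, 2 * P * fst z, 2 * P * fst z + 2 * P * snd z)"

text \<open>Label of the piece whose interior contains Xi_P(c), c the center of the square
  [m,m+1] x [n,n+1]; the label is a set of letters, i.e. directly the tile light set.\<close>
definition tile_light_set :: "nat \<Rightarrow> nat \<Rightarrow> int \<Rightarrow> int \<Rightarrow> edge set" where
  "tile_light_set p q m n =
     (THE L. Xi (PP p q) (of_int m + 1/2, of_int n + 1/2) \<in> interior (piece (PP p q) L))"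

end

theory Submission
  imports Defs
begin

text \<open>On a \<open>\<P>\<close>- or \<open>\<Q>\<close>-line with intercept \<open>k\<close>, \<open>F\<^sub>P\<close> or \<open>F\<^sub>Q\<close> takes the constant value \<open>Pk + 1\<close>
  mod 2, and \<open>F\<^sub>A\<close> is constant on each unit segment. Each edge of the square carries, up to
  coincidences, exactly two candidate light points, and it is good iff exactly one of them is light.
  Let \<open>i\<close> be an integer with \<open>t = T - 2i \<in> [-1,1]\<close>, where \<open>T\<close> is the first coordinate of \<open>\<Xi>\<^sub>P(c)\<close>,
  and let \<open>M = 2m + 2n + 1\<close>. The intercepts of the candidates are \<open>i\<close> and \<open>M - i\<close> up to small shifts that
  depend only on the fiber regime of \<open>t\<close>. Mod 2, \<open>Pi + 1\<close> and \<open>P(M - i) + 1\<close> are \<open>t - u\<close> and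
  \<open>v - P + 1\<close>, with \<open>(t, u, v)\<close> the lattice representative of \<open>\<Xi>\<^sub>P(c)\<close>, and the values \<open>F\<^sub>A\<close> are
  likewise linear in \<open>t, u, v, P\<close>. So goodness becomes a statement of linear arithmetic. It matches the
  labels of the rectangles because \<open>(p+q)t\<close> is odd while \<open>(p+q)u\<close>, \<open>(p+q)v\<close> are even, which keeps \<open>(u, v)\<close> off
  all walls of the fiber.

  Only \<open>t\<close> may lie on a boundary between regimes; there all admissible descriptions give
  the grid light set, so \<open>\<Xi>\<^sub>P(c)\<close> lies in a single piece. The pieces are closed, finitely many and cover
  space, hence the point is interior to that piece.\<close>

section \<open>Representatives modulo 2 and light values\<close>

definition lit :: "real \<Rightarrow> real \<Rightarrow> bool" where
  "lit f a \<longleftrightarrow> 0 < f \<and> f < a \<or> a < f \<and> f < 0"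

lemma lit_iff: "a * f > 0 \<and> \<bar>f\<bar> < \<bar>a\<bar> \<longleftrightarrow> lit f a"
  by (auto simp: lit_def zero_less_mult_iff)

text \<open>Agrees with \<^const>\<open>modrep\<close> on \<open>(-3, 3]\<close> only.\<close>

definition wrap :: "real \<Rightarrow> real" where
  "wrap x = (if x \<le> -1 then x + 2 else if x > 1 then x - 2 else x)"

lemma modrep_gt: "-1 < modrep x"
  and modrep_le: "modrep x \<le> 1"
proof -
  have "-1 < x - 2 * c \<and> x - 2 * c \<le> 1" if "c - 1 < (x - 1) / 2 \<and> (x - 1) / 2 \<le> c" for c :: real
    using that by argo
  thus "-1 < modrep x" "modrep x \<le> 1"
    unfolding modrep_def using ceiling_correct by blast+
qed

lemma modrep_cong:
  assumes "x - y = 2 * of_int k"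
  shows "modrep x = modrep y"
proof -
  have "(x - 1) / 2 = (y - 1) / 2 + of_int k"
    using assms by (simp add: field_simps)
  hence "\<lceil>(x - 1) / 2\<rceil> = \<lceil>(y - 1) / 2\<rceil> + k"
    by (metis ceiling_add_of_int)
  thus ?thesis
    using assms unfolding modrep_def by simp
qed

lemma modrep_id: "-1 < x \<Longrightarrow> x \<le> 1 \<Longrightarrow> modrep x = x"
proof -
  assume "-1 < x" "x \<le> 1"
  hence "\<lceil>(x - 1) / 2\<rceil> = 0"
    by (intro ceiling_unique) auto
  thus ?thesis by (simp add: modrep_def)
qed

lemma modrep_wrap:
  assumes "-3 < x" "x \<le> 3"
  shows "modrep x = wrap x"
proof -
  have "-1 < wrap x" "wrap x \<le> 1"
    using assms by (auto simp: wrap_def)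
  moreover have "\<exists>k::int. x - wrap x = 2 * of_int k"
    by (auto simp: wrap_def intro: exI[of _ "-1"] exI[of _ 1] exI[of _ 0])
  ultimately show ?thesis
    using modrep_cong modrep_id by metis
qed

lemma modrep_eqI:
  assumes "-1 < y" "y \<le> 1" "x - y = 2 * of_int k"
  shows "modrep x = y"
  using modrep_cong[OF assms(3)] modrep_id[OF assms(1,2)] by simp

lemma modrep_diff: "\<exists>k::int. x - modrep x = 2 * of_int k"
  unfolding modrep_def by auto

text \<open>The representative of \<open>g\<close> is that of \<open>a\<close> minus that of
  \<open>f\<close>, and if \<open>f\<close> lies strictly between 0 and \<open>a\<close>, then so
  does \<open>a - f\<close>.\<close>

lemma lit_complement:
  assumes "f + g = a + 2 * of_int k" "lit (modrep f) (modrep a)"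
  shows "lit (modrep g) (modrep a)"
proof -
  obtain k1 k2 :: int where k: "f - modrep f = 2 * of_int k1" "a - modrep a = 2 * of_int k2"
    using modrep_diff by metis
  have "modrep g = modrep a - modrep f"
  proof (rule modrep_eqI)
    show "g - (modrep a - modrep f) = 2 * of_int (k + k2 - k1)"
      using k assms(1) by simp
  qed (use assms(2) modrep_gt[of a] modrep_le[of a] modrep_gt[of f] modrep_le[of f] in \<open>auto simp: lit_def\<close>)
  thus ?thesis
    using assms(2) by (auto simp: lit_def)
qed

text \<open>One predicate serves both families: along a line with intercept \<open>k\<close> the
  value of \<open>FP\<close> or \<open>FQ\<close> is \<open>P * k + 1\<close> mod 2. The argument
  \<open>a\<close> is the value attached to the edge before reduction mod 2.\<close>

definition glow :: "real \<Rightarrow> real \<Rightarrow> int \<Rightarrow> bool" where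
  "glow P a k \<longleftrightarrow> lit (modrep (P * of_int k + 1)) (modrep a)"

lemma glow_wrap:
  assumes "P * of_int k + 1 - f = 2 * of_int r" "a - b = 2 * of_int s"
    and "-3 < f" "f \<le> 3" "-3 < b" "b \<le> 3"
  shows "glow P a k \<longleftrightarrow> lit (wrap f) (wrap b)"
  unfolding glow_def modrep_cong[OF assms(1)] modrep_cong[OF assms(2)]
  using assms by (simp add: modrep_wrap)

section \<open>Linear arithmetic in a single fiber\<close>

definition off_lattice :: "real \<Rightarrow> real \<Rightarrow> bool" where
  "off_lattice P x \<longleftrightarrow> (\<forall>j l :: int. x \<noteq> P * of_int j + 2 * of_int l)"

text \<open>Instances with small coefficients, a form that linear arithmetic can take up
  directly.\<close>

lemma off_lattice_small:
  assumes "off_lattice P x"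
  shows "x \<noteq> 0" "x \<noteq> 2" "x \<noteq> -2" "x \<noteq> P" "x \<noteq> P + 2" "x \<noteq> P - 2"
    "x \<noteq> -P" "x \<noteq> 2 - P" "x \<noteq> -2 - P"
    "x \<noteq> 2 * P" "x \<noteq> 2 * P - 2" "x \<noteq> -(2 * P)" "x \<noteq> 2 - 2 * P"
proof -
  have *: "x \<noteq> P * of_int j + 2 * of_int l" for j l :: int
    using assms unfolding off_lattice_def by blast
  show "x \<noteq> 0" using *[of 0 0] by simp
  show "x \<noteq> 2" using *[of 0 1] by simp
  show "x \<noteq> -2" using *[of 0 "-1"] by simp
  show "x \<noteq> P" using *[of 1 0] by simp
  show "x \<noteq> P + 2" using *[of 1 1] by simp
  show "x \<noteq> P - 2" using *[of 1 "-1"] by simp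
  show "x \<noteq> -P" using *[of "-1" 0] by simp
  show "x \<noteq> 2 - P" using *[of "-1" 1] by simp
  show "x \<noteq> -2 - P" using *[of "-1" "-1"] by simp
  show "x \<noteq> 2 * P" using *[of 2 0] by simp
  show "x \<noteq> 2 * P - 2" using *[of 2 "-1"] by simp
  show "x \<noteq> -(2 * P)" using *[of "-2" 0] by simp
  show "x \<noteq> 2 - 2 * P" using *[of "-2" 1] by simp
qed

text \<open>What remains of a square once its integers are forgotten. The differences in
  \<open>off\<close> decide where the values at the candidates vanish or meet the edge value, where
  the edge value of a horizontal edge jumps, and on which side of each wall \<open>u\<close> and
  \<open>v\<close> lie.\<close>

locale fiber_point =
  fixes P t u v :: real
  assumes P: "0 < P" "P < 1"
    and u: "-1 < u" "u < 1" and v: "-1 < v" "v < 1"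
    and off: "off_lattice P (u - t)" "off_lattice P (v - t)" "off_lattice P (u - 1)"
      "off_lattice P (v - 1)" "off_lattice P (v - u - 1)"
begin

lemmas generic = P u v off[THEN off_lattice_small(1)] off[THEN off_lattice_small(2)]
  off[THEN off_lattice_small(3)] off[THEN off_lattice_small(4)] off[THEN off_lattice_small(5)]
  off[THEN off_lattice_small(6)] off[THEN off_lattice_small(7)] off[THEN off_lattice_small(8)]
  off[THEN off_lattice_small(9)] off[THEN off_lattice_small(10)] off[THEN off_lattice_small(11)]
  off[THEN off_lattice_small(12)] off[THEN off_lattice_small(13)]

text \<open>In the next three lemmas the edges appear in the order North, South, East, West; the left sides
  list the values of \<open>F\<close> at the two candidate light points of the edge, the right sides its special column and row.\<close>

lemma lit_regime1:
  assumes "-1 \<le> t" "t \<le> -1 + P"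
  shows "(lit (wrap (t - u)) (wrap (v - u + P)) \<noteq> lit (wrap (v + P + 1)) (wrap (v - u + P))) \<longleftrightarrow>
      ((-1 \<le> u \<and> u \<le> t) \<noteq> (1 - P \<le> v \<and> v \<le> 2 - P + t))"
    and "(lit (wrap (t - u - P)) (wrap (v - u - P)) \<noteq> lit (wrap (v + 1)) (wrap (v - u - P))) \<longleftrightarrow>
      ((1 - P \<le> u \<and> u \<le> 2 - P + t) \<noteq> (-1 \<le> v \<and> v \<le> t))"
    and "(lit (wrap (t - u)) (wrap (t + 1 + P)) \<noteq> lit (wrap (v + P + 1)) (wrap (t + 1 + P))) \<longleftrightarrow>
      ((t \<le> u \<and> u \<le> 1 - P) \<noteq> (t \<le> v \<and> v \<le> 1 - P))"
    and "(lit (wrap (t - u - P)) (wrap (t + 1 - P)) \<noteq> lit (wrap (v + 1)) (wrap (t + 1 - P))) \<longleftrightarrow>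
      ((2 - P + t \<le> u \<and> u \<le> 1) \<noteq> (2 - P + t \<le> v \<and> v \<le> 1))"
  using assms generic unfolding lit_def wrap_def by (smt (z3))+

lemma lit_regime2:
  assumes "-1 + P \<le> t" "t \<le> 1 - P"
  shows "(lit (wrap (v + 1)) (wrap (v - u + P)) \<noteq> lit (wrap (v + P + 1)) (wrap (v - u + P))) \<longleftrightarrow>
      ((-1 \<le> u \<and> u \<le> -1 + P) \<noteq> (1 - P \<le> v \<and> v \<le> 1))"
    and "(lit (wrap (v - P + 1)) (wrap (v - u - P)) \<noteq> lit (wrap (v + 1)) (wrap (v - u - P))) \<longleftrightarrow>
      ((1 - P \<le> u \<and> u \<le> 1) \<noteq> (-1 \<le> v \<and> v \<le> -1 + P))"
    and "(lit (wrap (t - u)) (wrap (t + 1 + P)) \<noteq> lit (wrap (v + P + 1)) (wrap (t + 1 + P))) \<longleftrightarrow>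
      ((t \<le> u \<and> u \<le> 1 - P) \<noteq> (t \<le> v \<and> v \<le> 1 - P))"
    and "(lit (wrap (t - u)) (wrap (t + 1 - P)) \<noteq> lit (wrap (v - P + 1)) (wrap (t + 1 - P))) \<longleftrightarrow>
      ((-1 + P \<le> u \<and> u \<le> t) \<noteq> (-1 + P \<le> v \<and> v \<le> t))"
  using assms generic unfolding lit_def wrap_def by (smt (z3))+

lemma lit_regime3:
  assumes "1 - P \<le> t" "t \<le> 1"
  shows "(lit (wrap (t - u + P)) (wrap (v - u + P)) \<noteq> lit (wrap (v + 1)) (wrap (v - u + P))) \<longleftrightarrow>
      ((-2 + P + t \<le> u \<and> u \<le> -1 + P) \<noteq> (t \<le> v \<and> v \<le> 1))"
    and "(lit (wrap (t - u)) (wrap (v - u - P)) \<noteq> lit (wrap (v - P + 1)) (wrap (v - u - P))) \<longleftrightarrow>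
      ((t \<le> u \<and> u \<le> 1) \<noteq> (-2 + P + t \<le> v \<and> v \<le> -1 + P))"
    and "(lit (wrap (t - u + P)) (wrap (t + 1 + P)) \<noteq> lit (wrap (v + 1)) (wrap (t + 1 + P))) \<longleftrightarrow>
      ((-1 \<le> u \<and> u \<le> -2 + P + t) \<noteq> (-1 \<le> v \<and> v \<le> -2 + P + t))"
    and "(lit (wrap (t - u)) (wrap (t + 1 - P)) \<noteq> lit (wrap (v - P + 1)) (wrap (t + 1 - P))) \<longleftrightarrow>
      ((-1 + P \<le> u \<and> u \<le> t) \<noteq> (-1 + P \<le> v \<and> v \<le> t))"
  using assms generic unfolding lit_def wrap_def by (smt (z3))+
end


section \<open>Light points and good vertical edges\<close>

text \<open>Neighbouring squares share an edge, so light counts have to be analysed for South and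
  West only.\<close>

lemma good_North: "good p q m n North \<longleftrightarrow> good p q m (n + 1) South"
  and good_East: "good p q m n East \<longleftrightarrow> good p q (m + 1) n West"
  by (simp_all add: good_def light_count_def light_point_def FA_def is_horiz_def)

lemma card_pair_eq_1:
  assumes "x \<noteq> y"
  shows "card {z. z = x \<and> A \<or> z = y \<and> B} = 1 \<longleftrightarrow> A \<noteq> B"
proof -
  have "{z. z = x \<and> A \<or> z = y \<and> B} = (if A then {x} else {}) \<union> (if B then {y} else {})"
    by auto
  thus ?thesis
    using assms by auto
qed

locale even_rational =
  fixes p q :: nat
  assumes even_rat: "even_rat_param p q"
begin

abbreviation "P \<equiv> PP p q"
abbreviation "Q \<equiv> QQ p q"

lemma pq: "0 < p" "p < q" "odd (p + q)"
  using even_rat coprime_common_divisor[of p q 2] unfolding even_rat_param_def by auto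
 
lemma P_bounds: "0 < P" "P < 1"
  using pq by (auto simp: PP_def)

lemma Q_eq: "Q = 2 - P"
  using pq by (simp add: PP_def QQ_def field_simps)

lemma light_point_South_iff:
  "light_point p q m n South (x, y) \<longleftrightarrow>
     y = of_int n \<and> of_int m \<le> x \<and> x \<le> of_int m + 1 \<and>
     (\<exists>k. (of_int n + P * x = of_int k \<or> of_int n + Q * x = of_int k) \<and> glow P (2 * P * of_int n) k)"
proof -
  have on: "on_line s (x, y) \<longleftrightarrow> (\<exists>k. y + s * x = of_int k)" for s
    by (auto simp: on_line_def elim: Ints_cases)
  have "FP p q (x, y) = modrep (P * of_int k + 1)" if "y + P * x = of_int k" for k
    using that[symmetric] by (simp add: FP_def algebra_simps power2_eq_square)
  moreover have "FQ p q (x, y) = modrep (P * of_int k + 1)" if "y + Q * x = of_int k" for k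
    using that[symmetric] by (simp add: FQ_def algebra_simps)
  ultimately show ?thesis
    unfolding light_point_def on lit_iff
    by (fastforce simp: FA_def is_horiz_def FH_def glow_def)
qed

lemma light_point_West_iff:
  "light_point p q m n West (x, y) \<longleftrightarrow>
     x = of_int m \<and> of_int n \<le> y \<and> y \<le> of_int n + 1 \<and>
     (\<exists>k. (y + P * of_int m = of_int k \<or> y + Q * of_int m = of_int k) \<and> glow P (2 * P * of_int m) k)"
proof -
  have on: "on_line s (x, y) \<longleftrightarrow> (\<exists>k. y + s * x = of_int k)" for s
    by (auto simp: on_line_def elim: Ints_cases)
  have "FP p q (x, y) = modrep (P * of_int k + 1)" if "y + P * x = of_int k" for k
    using that[symmetric] by (simp add: FP_def algebra_simps power2_eq_square)
  moreover have "FQ p q (x, y) = modrep (P * of_int k + 1)" if "y + Q * x = of_int k" for k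
    using that[symmetric] by (simp add: FQ_def algebra_simps)
  ultimately show ?thesis
    unfolding light_point_def on lit_iff
    by (fastforce simp: FA_def is_horiz_def FV_def glow_def)
qed

text \<open>Clearing denominators gives \<open>4 * p * m = k * (p + q)\<close> with
  \<open>p + q\<close> odd, so \<open>k\<close> is even. This excludes a half-integral
  \<open>P * m\<close>.\<close>

lemma two_P_int:
  assumes "2 * P * of_int m = of_int k"
  shows "\<exists>l::int. P * of_int m = of_int l"
proof -
  have "real_of_int (4 * int p * m) = real_of_int (k * int (p + q))"
    using assms pq by (simp add: PP_def field_simps)
  hence *: "4 * int p * m = k * int (p + q)"
    by linarith
  moreover have "even (4 * int p * m)"
    by simp
  ultimately have "even k"
    using pq(3) by (metis even_mult_iff even_of_nat_iff)
  then obtain l where "k = 2 * l" ..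
  with assms have "P * of_int m = of_int l" by simp
  thus ?thesis ..
qed

text \<open>Since \<open>P + Q = 2\<close>, reflection in the midpoint of the edge exchanges its
  intersections with P-lines and Q-lines and sends intercept \<open>k\<close> to
  \<open>2 * m + 2 * n + 1 - k\<close>. The edge is as long as the spacing of the lines, so each
  family contributes one point unless its lines pass through both ends.\<close>

lemma good_West_iff:
  assumes "of_int n + P * of_int m \<le> of_int k" "of_int k \<le> of_int n + 1 + P * of_int m"
  shows "good p q m n West \<longleftrightarrow>
    glow P (2 * P * of_int m) k \<noteq> glow P (2 * P * of_int m) (2 * m + 2 * n + 1 - k)"
    (is "_ \<longleftrightarrow> ?g k \<noteq> ?g ?l")
proof (cases "\<exists>l::int. P * of_int m = of_int l")
  \<comment> \<open>Lines pass through both ends here, but \<open>FV\<close> vanishes on the edge,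
    so no point of it is light.\<close>
  case True
  then obtain l :: int where "P * of_int m = of_int l" ..
  hence "modrep (2 * P * of_int m) = 0"
    by (intro modrep_eqI[of _ _ l]) auto
  hence no_glow: "\<not> ?g k" for k
    by (simp add: glow_def lit_def)
  hence none: "light_point p q m n West z \<longleftrightarrow> False" for z
    by (cases z) (simp add: light_point_West_iff no_glow)
  show ?thesis
    by (simp add: good_def light_count_def is_horiz_def none no_glow)
next
  case False
  define yk where "yk j = of_int j - P * of_int m" for j :: int
  have yQ: "y + Q * of_int m = of_int j \<longleftrightarrow> y = 2 * of_int n + 1 - yk (2 * m + 2 * n + 1 - j)" for j y
    by (auto simp: yk_def Q_eq algebra_simps)
  \<comment> \<open>Two P-lines can meet the edge only at its two ends, which would make
    \<open>P * m\<close> an integer.\<close>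
  have uniq: "j = k" if "of_int n \<le> yk j" "yk j \<le> of_int n + 1" for j
  proof (rule ccontr)
    assume "j \<noteq> k"
    hence "j \<le> k - 1 \<or> k + 1 \<le> j" by linarith
    hence "P * of_int m = of_int (k - n) \<or> P * of_int m = of_int (k - 1 - n)"
      using that assms unfolding yk_def by auto
    thus False using False by blast
  qed
  \<comment> \<open>The two candidates can coincide only at the midpoint, where
    \<open>2 * P * m\<close> would be an odd integer.\<close>
  have ne: "yk k \<noteq> 2 * of_int n + 1 - yk k"
  proof
    assume "yk k = 2 * of_int n + 1 - yk k"
    hence "2 * P * of_int m = of_int (2 * k - 2 * n - 1)"
      by (simp add: yk_def)
    thus False using two_P_int False by blast
  qed
  have "light_point p q m n West (x, y) \<longleftrightarrow>
      (x, y) = (of_int m, yk k) \<and> ?g k \<or> (x, y) = (of_int m, 2 * of_int n + 1 - yk k) \<and> ?g ?l" for x y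
  proof
    assume "light_point p q m n West (x, y)"
    then obtain j where j: "x = of_int m" "of_int n \<le> y" "y \<le> of_int n + 1" "?g j"
      "y = yk j \<or> y = 2 * of_int n + 1 - yk (2 * m + 2 * n + 1 - j)"
      unfolding light_point_West_iff yQ by (auto simp: yk_def algebra_simps)
    from j(5) show "(x, y) = (of_int m, yk k) \<and> ?g k \<or> (x, y) = (of_int m, 2 * of_int n + 1 - yk k) \<and> ?g ?l"
    proof
      assume "y = yk j"
      with uniq[of j] j show ?thesis by auto
    next
      assume y: "y = 2 * of_int n + 1 - yk (2 * m + 2 * n + 1 - j)"
      with uniq[of "2 * m + 2 * n + 1 - j"] j have eq: "2 * m + 2 * n + 1 - j = k" by auto
      hence "j = ?l" by simp
      with y eq j show ?thesis by auto
    qed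
  next
    let ?y = "2 * of_int n + 1 - yk k"
    have "yk k + P * of_int m = of_int k" "of_int n \<le> yk k" "yk k \<le> of_int n + 1"
      "of_int n \<le> ?y" "?y \<le> of_int n + 1"
      using assms by (auto simp: yk_def)
    moreover have "?y + Q * of_int m = of_int ?l"
      unfolding yQ by simp
    moreover assume "(x, y) = (of_int m, yk k) \<and> ?g k \<or> (x, y) = (of_int m, ?y) \<and> ?g ?l"
    ultimately show "light_point p q m n West (x, y)"
      unfolding light_point_West_iff prod.inject by metis
  qed
  hence "{z. light_point p q m n West z} =
      {z. z = (of_int m, yk k) \<and> ?g k \<or> z = (of_int m, 2 * of_int n + 1 - yk k) \<and> ?g ?l}"
    by auto
  thus ?thesis
    using card_pair_eq_1[of "(of_int m, yk k)" "(of_int m, 2 * of_int n + 1 - yk k)"] ne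
    by (simp add: good_def light_count_def is_horiz_def)
qed

text \<open>Where two lines cross on a horizontal edge, \<open>F\<^sub>P + F\<^sub>Q = F\<^sub>H\<close> mod 2, so both values lie strictly between
  \<open>0\<close> and \<open>F\<^sub>H\<close> or neither does.\<close>

lemma glow_at_crossing:
  assumes "of_int n + P * x = of_int k" "of_int n + Q * x = of_int l"
  shows "glow P (2 * P * of_int n) k \<longleftrightarrow> glow P (2 * P * of_int n) l"
proof -
  have "2 * x = of_int (k + l - 2 * n)"
    using assms by (simp add: Q_eq algebra_simps)
  hence "P * of_int k + 1 + (P * of_int l + 1) = P * (2 * of_int n + 2 * x) + 2"
    by (simp add: algebra_simps)
  also have "\<dots> = 2 * P * of_int n + 2 * of_int (k - n + 1)"
    using assms(1) by (simp add: algebra_simps)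
  finally have *: "P * of_int k + 1 + (P * of_int l + 1) = 2 * P * of_int n + 2 * of_int (k - n + 1)" .
  hence "P * of_int l + 1 + (P * of_int k + 1) = 2 * P * of_int n + 2 * of_int (k - n + 1)"
    by simp
  with * show ?thesis
    unfolding glow_def using lit_complement by blast
qed

text \<open>The midpoint rule is what makes the two candidates count separately when they coincide at the
  midpoint. Coincidences at an end of the edge must, on the contrary, be absorbed into a single candidate.\<close>

lemma good_South_of_two_points:
  assumes A: "of_int m \<le> xA" "xA \<le> of_int m + 1" "of_int n + P * xA = of_int kA \<or> of_int n + Q * xA = of_int kA"
    and B: "of_int m \<le> xB" "xB \<le> of_int m + 1" "of_int n + P * xB = of_int kB \<or> of_int n + Q * xB = of_int kB"
    and all: "\<And>x k. \<lbrakk>of_int m \<le> x; x \<le> of_int m + 1; of_int n + P * x = of_int k \<or> of_int n + Q * x = of_int k;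
        glow P (2 * P * of_int n) k\<rbrakk> \<Longrightarrow>
        x = xA \<and> glow P (2 * P * of_int n) kA \<or> x = xB \<and> glow P (2 * P * of_int n) kB"
    and mid: "xA = of_int m + 1 / 2 \<or> xB = of_int m + 1 / 2 \<or> xA = xB \<Longrightarrow>
        xA = of_int m + 1 / 2 \<and> xB = of_int m + 1 / 2 \<and> of_int n + P * xA = of_int kA \<and> of_int n + Q * xA = of_int kB"
  shows "good p q m n South \<longleftrightarrow> glow P (2 * P * of_int n) kA \<noteq> glow P (2 * P * of_int n) kB"
    (is "_ \<longleftrightarrow> ?g kA \<noteq> ?g kB")
proof -
  have set: "{z. light_point p q m n South z} = {z. z = (xA, of_int n) \<and> ?g kA \<or> z = (xB, of_int n) \<and> ?g kB}"
    (is "?L = ?R")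
  proof -
    have "light_point p q m n South (x, y) \<longleftrightarrow>
        (x, y) = (xA, of_int n) \<and> ?g kA \<or> (x, y) = (xB, of_int n) \<and> ?g kB" for x y
      unfolding light_point_South_iff using A B all by blast
    thus ?thesis by auto
  qed
  show ?thesis
  proof (cases "xA = of_int m + 1 / 2 \<or> xB = of_int m + 1 / 2 \<or> xA = xB")
    case True
    note * = mid[OF True]
    hence g: "?g kA \<longleftrightarrow> ?g kB"
      using glow_at_crossing by blast
    \<comment> \<open>At the midpoint both candidates are light or neither is, so the light count is
      2 or 0, never 1.\<close>
    have "?L = (if ?g kA then {seg_mid m n South} else {})"
      unfolding set using * g by auto
    thus ?thesis
      using g by (auto simp: good_def light_count_def is_horiz_def split: if_splits)
  next
    case False
    hence "seg_mid m n South \<notin> ?R" by auto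
    hence "\<not> light_point p q m n South (seg_mid m n South)"
      using set by blast
    moreover have "card ?R = 1 \<longleftrightarrow> ?g kA \<noteq> ?g kB"
      using False by (intro card_pair_eq_1) auto
    ultimately show ?thesis
      by (simp add: good_def light_count_def set)
  qed
qed


section \<open>Good horizontal edges in the three fiber regimes\<close>

lemma Q_bounds: "0 < Q" "1 < Q" "Q < 2"
  using Q_eq P_bounds by auto

lemma P_cancel: "P * x = P * y \<Longrightarrow> x = y"
  and Q_cancel: "Q * x = Q * y \<Longrightarrow> x = y"
  using P_bounds Q_bounds by simp_all

text \<open>Adding \<open>n\<close> gives the intercept \<open>i - (1 - t) / 2\<close> of the line
  of slope \<open>-P\<close> through the midpoint of the south edge. For slope \<open>-Q\<close> the
  intercept is \<open>M - i + (1 - t) / 2\<close>, where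
  \<open>M = 2 * m + 2 * n + 1\<close>.\<close>

lemma P_center:
  assumes "P * (2 * of_int m + 1) + (2 * of_int n + 1) = 2 * of_int i + t"
  shows "P * (of_int m + 1 / 2) = of_int i + (t - 1) / 2 - of_int n"
  using assms by (simp add: field_simps)

lemma Q_center:
  assumes "P * (2 * of_int m + 1) + (2 * of_int n + 1) = 2 * of_int i + t"
  shows "Q * (of_int m + 1 / 2) = 2 * of_int m + 1 - (of_int i + (t - 1) / 2 - of_int n)"
  unfolding P_center[OF assms, symmetric] Q_eq by (simp add: algebra_simps)

text \<open>Positions are measured from the midpoint, so a P-line enters through
  \<open>k - i\<close> and \<open>t\<close> alone, a Q-line through \<open>k - (M - i)\<close> and
  \<open>t\<close>. Bounding \<open>P * d\<close> and \<open>Q * d\<close> instead of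
  \<open>d\<close> keeps the search for intercepts linear: the windows have lengths
  \<open>P < 1\<close> and \<open>1 < Q < 2\<close>, so at most one P-line and at most two Q-lines
  meet the edge.\<close>

lemma good_South_of_offsets:
  fixes m n i :: int
  assumes t: "P * (2 * of_int m + 1) + (2 * of_int n + 1) = 2 * of_int i + t"
  defines "M \<equiv> 2 * m + 2 * n + 1"
  defines "pline \<equiv> \<lambda>d k. P * d = of_int k - of_int i + (1 - t) / 2"
    and "qline \<equiv> \<lambda>d k. Q * d = of_int k - of_int (M - i) - (1 - t) / 2"
    and "g \<equiv> glow P (2 * P * of_int n)"
  assumes A: "\<bar>dA\<bar> \<le> 1 / 2" "pline dA kA \<or> qline dA kA"
    and B: "\<bar>dB\<bar> \<le> 1 / 2" "pline dB kB \<or> qline dB kB"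
    and p_all: "\<And>d k. \<lbrakk>- (P / 2) \<le> P * d; P * d \<le> P / 2; pline d k; g k\<rbrakk> \<Longrightarrow> d = dA \<and> g kA \<or> d = dB \<and> g kB"
    and q_all: "\<And>d k. \<lbrakk>- (Q / 2) \<le> Q * d; Q * d \<le> Q / 2; qline d k; g k\<rbrakk> \<Longrightarrow> d = dA \<and> g kA \<or> d = dB \<and> g kB"
    and mid: "dA = 0 \<or> dB = 0 \<or> dA = dB \<Longrightarrow> dA = 0 \<and> dB = 0 \<and> pline 0 kA \<and> qline 0 kB"
  shows "good p q m n South \<longleftrightarrow> g kA \<noteq> g kB"
proof -
  define c where "c = real_of_int m + 1 / 2"
  have p_iff: "of_int n + P * x = of_int k \<longleftrightarrow> pline (x - c) k" for x k
    unfolding pline_def right_diff_distrib c_def P_center[OF t] by argo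
  have q_iff: "of_int n + Q * x = of_int k \<longleftrightarrow> qline (x - c) k" for x k
    unfolding qline_def right_diff_distrib c_def Q_center[OF t] M_def of_int_diff of_int_add of_int_mult of_int_numeral of_int_1 by argo
  have bd: "- (s / 2) \<le> s * d" "s * d \<le> s / 2" if "\<bar>d\<bar> \<le> 1 / 2" "s > 0" for s d :: real
  proof -
    have "\<bar>s * d\<bar> \<le> s / 2"
      using mult_left_mono[OF that(1), of s] that(2) by (simp add: abs_mult)
    thus "- (s / 2) \<le> s * d" "s * d \<le> s / 2" by linarith+
  qed
  have "good p q m n South \<longleftrightarrow> glow P (2 * P * of_int n) kA \<noteq> glow P (2 * P * of_int n) kB"
  proof (rule good_South_of_two_points[of m "c + dA" n kA "c + dB" kB])
    show "c + dA = of_int m + 1 / 2 \<and> c + dB = of_int m + 1 / 2 \<and> of_int n + P * (c + dA) = of_int kA \<and>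
        of_int n + Q * (c + dA) = of_int kB"
      if "c + dA = of_int m + 1 / 2 \<or> c + dB = of_int m + 1 / 2 \<or> c + dA = c + dB"
    proof -
      have "dA = 0 \<or> dB = 0 \<or> dA = dB"
        using that unfolding c_def by argo
      from mid[OF this] show ?thesis
        unfolding p_iff q_iff by (simp add: c_def)
    qed
    fix x k
    assume x: "of_int m \<le> x" "x \<le> of_int m + 1"
      and k: "of_int n + P * x = of_int k \<or> of_int n + Q * x = of_int k"
      and gk: "glow P (2 * P * of_int n) k"
    from x have d: "\<bar>x - c\<bar> \<le> 1 / 2"
      unfolding c_def abs_le_iff by argo
    from k have "x - c = dA \<and> g kA \<or> x - c = dB \<and> g kB"
      unfolding p_iff q_iff
      using p_all[OF bd[OF d P_bounds(1)]] q_all[OF bd[OF d Q_bounds(1)]] gk g_def by blast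
    thus "x = c + dA \<and> glow P (2 * P * of_int n) kA \<or> x = c + dB \<and> glow P (2 * P * of_int n) kB"
      unfolding g_def by auto
  qed (use A B in \<open>auto simp: p_iff q_iff c_def abs_le_iff\<close>)
  thus ?thesis
    unfolding g_def .
qed

text \<open>Serves the boundaries between regimes, where an additional line enters at an end of the
  edge, exactly at a candidate from the other family.\<close>

lemma glow_at_crossing_offset:
  fixes m n i :: int
  assumes t: "P * (2 * of_int m + 1) + (2 * of_int n + 1) = 2 * of_int i + t"
    and "P * d = of_int k - of_int i + (1 - t) / 2"
    and "Q * d = of_int l - of_int (2 * m + 2 * n + 1 - i) - (1 - t) / 2"
  shows "glow P (2 * P * of_int n) k \<longleftrightarrow> glow P (2 * P * of_int n) l"
proof (rule glow_at_crossing)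
  show "of_int n + P * (of_int m + 1 / 2 + d) = of_int k"
    unfolding distrib_left[of P _ d] assms(2) P_center[OF t] by argo
  show "of_int n + Q * (of_int m + 1 / 2 + d) = of_int l"
    unfolding distrib_left[of Q _ d] assms(3) Q_center[OF t] of_int_diff of_int_add of_int_mult of_int_numeral of_int_1 by argo
qed

context
  fixes m n i :: int and t :: real
  assumes t: "P * (2 * of_int m + 1) + (2 * of_int n + 1) = 2 * of_int i + t"
begin

abbreviation "M \<equiv> 2 * m + 2 * n + 1"

text \<open>The candidates are one P-line point in the left half of the edge and one Q-line point in
  the right half.\<close>

lemma good_South_regime1:
  assumes "-1 \<le> t" "t \<le> -1 + P"
  shows "good p q m n South \<longleftrightarrow>
    glow P (2 * P * of_int n) (i - 1) \<noteq> glow P (2 * P * of_int n) (M - i + 1)"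
proof -
  let ?dA = "- (1 + t) / (2 * P)" and ?dB = "(1 + t) / (2 * Q)"
  have PA: "P * ?dA = - (1 + t) / 2" and QB: "Q * ?dB = (1 + t) / 2"
    using P_bounds Q_bounds by simp_all
  show ?thesis
  proof (rule good_South_of_offsets[OF t, of ?dA _ ?dB])
    show "\<bar>?dA\<bar> \<le> 1 / 2" "\<bar>?dB\<bar> \<le> 1 / 2"
      using assms P_bounds Q_bounds by (auto simp: abs_le_iff field_simps)
    show "?dA = 0 \<and> ?dB = 0 \<and> P * 0 = of_int (i - 1) - of_int i + (1 - t) / 2 \<and>
        Q * 0 = of_int (M - i + 1) - of_int (M - i) - (1 - t) / 2"
      if "?dA = 0 \<or> ?dB = 0 \<or> ?dA = ?dB"
    proof -
      have "?dA \<le> 0" "0 \<le> ?dB"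
        using assms P_bounds Q_bounds by (auto intro: divide_nonneg_pos divide_nonpos_pos)
      hence "?dA = 0 \<or> ?dB = 0"
        using that by linarith
      \<comment> \<open>At \<open>t = -1\<close> both candidates sit at the midpoint, one from each
        family.\<close>
      hence "t = -1"
        using P_bounds Q_bounds by auto
      thus ?thesis by simp
    qed
  next
    fix d k
    assume d: "- (P / 2) \<le> P * d" "P * d \<le> P / 2" "P * d = of_int k - of_int i + (1 - t) / 2"
      and g: "glow P (2 * P * of_int n) k"
    \<comment> \<open>The window for \<open>P * d\<close> is shorter than 1 and contains the value
      belonging to \<open>i - 1\<close>, so it leaves no other intercept.\<close>
    have "real_of_int k < of_int i" "real_of_int i < of_int k + 2"
      using d(1,2) assms P_bounds unfolding d(3) by argo+
    hence k: "k = i - 1" by linarith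
    have "d = ?dA"
      by (rule P_cancel) (unfold d(3) PA k, simp add: field_simps)
    thus "d = ?dA \<and> glow P (2 * P * of_int n) (i - 1) \<or> d = ?dB \<and> glow P (2 * P * of_int n) (M - i + 1)"
      using g k by simp
  next
    fix d k
    assume d: "- (Q / 2) \<le> Q * d" "Q * d \<le> Q / 2" "Q * d = of_int k - of_int (M - i) - (1 - t) / 2"
      and g: "glow P (2 * P * of_int n) k"
    have "of_int (M - i) < real_of_int k + 1" "real_of_int k < of_int (M - i) + 2"
      using d(1,2) assms P_bounds unfolding d(3) unfolding Q_eq by argo+
    hence "k = M - i \<or> k = M - i + 1" by linarith
    thus "d = ?dA \<and> glow P (2 * P * of_int n) (i - 1) \<or> d = ?dB \<and> glow P (2 * P * of_int n) (M - i + 1)"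
    proof
      assume k: "k = M - i + 1"
      have "d = ?dB"
        by (rule Q_cancel) (unfold d(3) QB k, simp add: field_simps)
      thus ?thesis
        using g k by simp
    next
      \<comment> \<open>A second Q-line reaches the edge only at its left end, for
        \<open>t = -1 + P\<close>; there it crosses the P-line of the first candidate.\<close>
      assume k: "k = M - i"
      have t': "t = -1 + P"
        using d(1,2) assms(2) unfolding d(3) k of_int_diff[of _ 1] of_int_add of_int_1 unfolding Q_eq by argo
      have d': "d = - 1 / 2"
        by (rule Q_cancel) (unfold d(3) k t', unfold Q_eq, simp add: field_simps)
      hence "d = ?dA"
        using t' P_bounds by simp
      moreover have "glow P (2 * P * of_int n) (i - 1)"
        using glow_at_crossing_offset[OF t _ d(3), of "i - 1"] g t' by (simp add: d' field_simps)
      ultimately show ?thesis by blast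
    qed
  qed (simp_all only: PA QB, simp_all add: field_simps)
qed

text \<open>Both candidates are Q-line points, one on each side of the midpoint. A P-line touches
  the edge only at an end, for \<open>t\<close> on a boundary of the regime, and there it crosses a
  candidate Q-line.\<close>

lemma good_South_regime2:
  assumes "-1 + P \<le> t" "t \<le> 1 - P"
  shows "good p q m n South \<longleftrightarrow>
    glow P (2 * P * of_int n) (M - i) \<noteq> glow P (2 * P * of_int n) (M - i + 1)"
proof -
  let ?dA = "- (1 - t) / (2 * Q)" and ?dB = "(1 + t) / (2 * Q)"
  have QA: "Q * ?dA = - (1 - t) / 2" and QB: "Q * ?dB = (1 + t) / 2"
    using Q_bounds by simp_all
  show ?thesis
  proof (rule good_South_of_offsets[OF t, of ?dA _ ?dB])
    show "\<bar>?dA\<bar> \<le> 1 / 2" "\<bar>?dB\<bar> \<le> 1 / 2"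
      using assms P_bounds Q_bounds Q_eq by (auto simp: abs_le_iff field_simps)
    show "?dA = 0 \<and> ?dB = 0 \<and> P * 0 = of_int (M - i) - of_int i + (1 - t) / 2 \<and>
        Q * 0 = of_int (M - i + 1) - of_int (M - i) - (1 - t) / 2"
      if "?dA = 0 \<or> ?dB = 0 \<or> ?dA = ?dB"
    proof -
      \<comment> \<open>The candidates lie strictly on opposite sides, so the midpoint case cannot
        arise.\<close>
      have "?dA < 0" "0 < ?dB"
        using assms P_bounds Q_bounds by (auto intro: divide_pos_pos divide_neg_pos)
      with that show ?thesis by linarith
    qed
  next
    fix d k
    assume d: "- (P / 2) \<le> P * d" "P * d \<le> P / 2" "P * d = of_int k - of_int i + (1 - t) / 2"
      and g: "glow P (2 * P * of_int n) k"
    have "real_of_int k < of_int i + 1" "real_of_int i < of_int k + 2"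
      using d(1,2) assms P_bounds unfolding d(3) by argo+
    hence "k = i - 1 \<or> k = i" by linarith
    thus "d = ?dA \<and> glow P (2 * P * of_int n) (M - i) \<or> d = ?dB \<and> glow P (2 * P * of_int n) (M - i + 1)"
    proof
      assume k: "k = i - 1"
      have t': "t = -1 + P"
        using d(1,2) assms unfolding d(3) k of_int_diff of_int_1 by argo
      have d': "d = - 1 / 2"
        by (rule P_cancel) (unfold d(3) k t', simp add: field_simps)
      have "d = ?dA"
        using t' Q_bounds Q_eq by (simp add: d' field_simps)
      moreover have "glow P (2 * P * of_int n) (M - i)"
        using glow_at_crossing_offset[OF t d(3), of "M - i"] g t' Q_eq by (simp add: d' field_simps)
      ultimately show ?thesis by blast
    next
      assume k: "k = i"
      have t': "t = 1 - P"
        using d(1,2) assms unfolding d(3) k of_int_diff of_int_1 by argo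
      have d': "d = 1 / 2"
        by (rule P_cancel) (unfold d(3) k t', simp add: field_simps)
      have "d = ?dB"
        using t' Q_bounds Q_eq by (simp add: d' field_simps)
      moreover have "glow P (2 * P * of_int n) (M - i + 1)"
        using glow_at_crossing_offset[OF t d(3), of "M - i + 1"] g t' Q_eq by (simp add: d' field_simps)
      ultimately show ?thesis by blast
    qed
  next
    fix d k
    assume d: "- (Q / 2) \<le> Q * d" "Q * d \<le> Q / 2" "Q * d = of_int k - of_int (M - i) - (1 - t) / 2"
      and g: "glow P (2 * P * of_int n) k"
    have "of_int (M - i) < real_of_int k + 1" "real_of_int k < of_int (M - i) + 2"
      using d(1,2) assms P_bounds unfolding d(3) unfolding Q_eq by argo+
    hence "k = M - i \<or> k = M - i + 1" by linarith
    thus "d = ?dA \<and> glow P (2 * P * of_int n) (M - i) \<or> d = ?dB \<and> glow P (2 * P * of_int n) (M - i + 1)"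
    proof
      assume k: "k = M - i + 1"
      have "d = ?dB"
        by (rule Q_cancel) (unfold d(3) QB k, simp add: field_simps)
      thus ?thesis
        using g k by simp
    next
      assume k: "k = M - i"
      have "d = ?dA"
        by (rule Q_cancel) (unfold d(3) QA k, simp add: field_simps)
      thus ?thesis
        using g k by simp
    qed
  qed (simp_all only: QA QB, simp_all add: field_simps)
qed

text \<open>Mirror image of the first regime: the P-line point is now in the right half, the Q-line
  point in the left half, and they meet at the midpoint for \<open>t = 1\<close>.\<close>

lemma good_South_regime3:
  assumes "1 - P \<le> t" "t \<le> 1"
  shows "good p q m n South \<longleftrightarrow>
    glow P (2 * P * of_int n) i \<noteq> glow P (2 * P * of_int n) (M - i)"
proof -
  let ?dA = "(1 - t) / (2 * P)" and ?dB = "- (1 - t) / (2 * Q)"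
  have PA: "P * ?dA = (1 - t) / 2" and QB: "Q * ?dB = - (1 - t) / 2"
    using P_bounds Q_bounds by simp_all
  show ?thesis
  proof (rule good_South_of_offsets[OF t, of ?dA _ ?dB])
    show "\<bar>?dA\<bar> \<le> 1 / 2" "\<bar>?dB\<bar> \<le> 1 / 2"
      using assms P_bounds Q_bounds by (auto simp: abs_le_iff field_simps)
    show "?dA = 0 \<and> ?dB = 0 \<and> P * 0 = of_int i - of_int i + (1 - t) / 2 \<and>
        Q * 0 = of_int (M - i) - of_int (M - i) - (1 - t) / 2"
      if "?dA = 0 \<or> ?dB = 0 \<or> ?dA = ?dB"
    proof -
      have "?dB \<le> 0" "0 \<le> ?dA"
        using assms P_bounds Q_bounds by (auto intro: divide_nonneg_pos divide_nonpos_pos)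
      hence "?dA = 0 \<or> ?dB = 0"
        using that by linarith
      hence "t = 1"
        using P_bounds Q_bounds by auto
      thus ?thesis by simp
    qed
  next
    fix d k
    assume d: "- (P / 2) \<le> P * d" "P * d \<le> P / 2" "P * d = of_int k - of_int i + (1 - t) / 2"
      and g: "glow P (2 * P * of_int n) k"
    have "real_of_int k < of_int i + 1" "real_of_int i < of_int k + 1"
      using d(1,2) assms P_bounds unfolding d(3) by argo+
    hence k: "k = i" by linarith
    have "d = ?dA"
      by (rule P_cancel) (unfold d(3) PA k, simp add: field_simps)
    thus "d = ?dA \<and> glow P (2 * P * of_int n) i \<or> d = ?dB \<and> glow P (2 * P * of_int n) (M - i)"
      using g k by simp
  next
    fix d k
    assume d: "- (Q / 2) \<le> Q * d" "Q * d \<le> Q / 2" "Q * d = of_int k - of_int (M - i) - (1 - t) / 2"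
      and g: "glow P (2 * P * of_int n) k"
    have "of_int (M - i) < real_of_int k + 1" "real_of_int k < of_int (M - i) + 2"
      using d(1,2) assms P_bounds unfolding d(3) unfolding Q_eq by argo+
    hence "k = M - i \<or> k = M - i + 1" by linarith
    thus "d = ?dA \<and> glow P (2 * P * of_int n) i \<or> d = ?dB \<and> glow P (2 * P * of_int n) (M - i)"
    proof
      assume k: "k = M - i"
      have "d = ?dB"
        by (rule Q_cancel) (unfold d(3) QB k, simp add: field_simps)
      thus ?thesis
        using g k by simp
    next
      \<comment> \<open>The second Q-line appears only at the right end, for
        \<open>t = 1 - P\<close>, where it crosses the candidate P-line.\<close>
      assume k: "k = M - i + 1"
      have t': "t = 1 - P"
        using d(1,2) assms(1) unfolding d(3) k of_int_add[of _ 1] of_int_1 unfolding Q_eq by argo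
      have d': "d = 1 / 2"
        by (rule Q_cancel) (unfold d(3) k t', unfold Q_eq, simp add: field_simps)
      hence "d = ?dA"
        using t' P_bounds by simp
      moreover have "glow P (2 * P * of_int n) i"
        using glow_at_crossing_offset[OF t _ d(3), of i] g t' by (simp add: d' field_simps)
      ultimately show ?thesis by blast
    qed
  qed (simp_all only: PA QB, simp_all add: field_simps)
qed

end
end


section \<open>Labels and cells of a fiber\<close>

lemma spos_col_inj: "fst (spos k e) = fst (spos k e') \<longleftrightarrow> e = e'"
  by (cases e; cases e') (auto simp: spos_def)

lemma spos_row_inj: "snd (spos k e) = snd (spos k e') \<longleftrightarrow> e = e'"
  by (cases e; cases e') (auto simp: spos_def)

lemma spos_range: "fst (spos k e) \<in> {1..4}" "snd (spos k e) \<in> {1..4}"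
  by (cases e; auto simp: spos_def)+

text \<open>The exclusive or also accounts for the special rectangles: there column and row name the
  same letter, which cancels to the empty label.\<close>

lemma rect_label_iff: "e \<in> rect_label k a b \<longleftrightarrow> (fst (spos k e) = a) \<noteq> (snd (spos k e) = b)"
proof (cases "\<exists>X. spos k X = (a, b)")
  case True
  then obtain X where "spos k X = (a, b)" ..
  hence "a = fst (spos k X)" "b = snd (spos k X)" by simp_all
  thus ?thesis
    by (auto simp: rect_label_def spos_col_inj spos_row_inj)
next
  case False
  hence "\<not> (fst (spos k e) = a \<and> snd (spos k e) = b)"
    by (metis prod.collapse)
  thus ?thesis
    using False by (auto simp: rect_label_def)
qed

text \<open>As \<open>u\<close> avoids all cuts, the weak inequalities single out one cell, even if
  neighbouring cuts coincide and some cells degenerate.\<close>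

lemma sorted_cell_unique:
  assumes "sorted cs" "u \<notin> set cs" "a \<in> {1..<length cs}" "c \<in> {1..<length cs}"
    and "cs ! (a - 1) \<le> u" "u \<le> cs ! a"
  shows "c = a \<longleftrightarrow> cs ! (c - 1) \<le> u \<and> u \<le> cs ! c"
proof -
  have ne: "u \<noteq> cs ! j" if "j < length cs" for j
    using assms(2) that by (metis nth_mem)
  have "\<not> u \<le> cs ! c" if "c < a"
  proof -
    have "cs ! c \<le> cs ! (a - 1)"
      using that assms(3) by (intro sorted_nth_mono[OF assms(1)]) auto
    thus ?thesis
      using assms(4,5) ne[of c] by auto
  qed
  moreover have "\<not> cs ! (c - 1) \<le> u" if "a < c"
  proof -
    have "cs ! a \<le> cs ! (c - 1)"
      using that assms(4) by (intro sorted_nth_mono[OF assms(1)]) auto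
    moreover have "u \<noteq> cs ! (c - 1)"
      using assms(4) by (intro ne) auto
    ultimately show ?thesis
      using assms(6) by auto
  qed
  ultimately show ?thesis
    using assms(5,6) by (metis linorder_neqE_nat)
qed

section \<open>From a square to its point in the fiber\<close>

context even_rational
begin

text \<open>Because \<open>P * (p + q) = 2 * p\<close>, multiplying \<open>P * j + 2 * l\<close> by
  \<open>p + q\<close> always gives an even integer.\<close>

lemma off_lattice_odd:
  assumes "x * real (p + q) = of_int c" "odd c"
  shows "off_lattice P x"
  unfolding off_lattice_def
proof (intro allI notI)
  fix j l :: int
  assume "x = P * of_int j + 2 * of_int l"
  hence "real_of_int c = of_int (2 * (int p * j + int (p + q) * l))"
    using assms(1) pq by (simp add: PP_def field_simps)
  hence "c = 2 * (int p * j + int (p + q) * l)"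
    by linarith
  with assms(2) show False by simp
qed

lemma good_wrap:
  assumes "good p q m n e \<longleftrightarrow> glow P a k \<noteq> glow P a l"
    and "P * of_int k + 1 - f = 2 * of_int r" "P * of_int l + 1 - g = 2 * of_int r'"
    and "a - b = 2 * of_int s"
    and "-3 < f" "f \<le> 3" "-3 < g" "g \<le> 3" "-3 < b" "b \<le> 3"
  shows "good p q m n e \<longleftrightarrow> lit (wrap f) (wrap b) \<noteq> lit (wrap g) (wrap b)"
  using assms by (simp add: glow_wrap)

end

text \<open>\<open>(t, u, v)\<close> is \<open>Xi\<close> of the center minus a lattice vector with
  coefficients \<open>i\<close>, \<open>j\<close>, \<open>j'\<close>. No normal form is chosen, so
  all representatives with \<open>u\<close>, \<open>v\<close> in \<open>[-1,1]\<close> are treated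
  at once, including both choices at \<open>t = 1\<close> and \<open>t = -1\<close>.\<close>

locale plaid_fiber = even_rational +
  fixes m n i j j' :: int and t u v :: real
  assumes t: "P * (2 * of_int m + 1) + (2 * of_int n + 1) = 2 * of_int i + t"
    and u_lift: "P * (2 * of_int m + 1) = P * of_int i + 2 * of_int j + u"
    and v_lift: "P * (2 * of_int m + 1) + P * (2 * of_int n + 1) = P * of_int i + 2 * of_int j' + v"
    and range: "-1 \<le> u" "u \<le> 1" "-1 \<le> v" "v \<le> 1"
begin

lemma t_eq: "t = P * (2 * of_int m + 1) + (2 * of_int n + 1) - 2 * of_int i"
  and u_eq: "u = P * (2 * of_int m + 1) - P * of_int i - 2 * of_int j"
  and v_eq: "v = P * (2 * of_int m + 1) + P * (2 * of_int n + 1) - P * of_int i - 2 * of_int j'"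
  using t u_lift v_lift by simp_all

sublocale fiber_point P t u v
proof -
  \<comment> \<open>Scaling by \<open>p + q\<close> clears denominators; \<open>tw\<close>,
    \<open>uw\<close>, \<open>vw\<close> are the resulting integers, and their parities give every
    condition in \<open>off\<close>.\<close>
  define w where "w = int (p + q)"
  define tw uw vw where "tw = 2 * int p * (2 * m + 1) + w * (2 * n + 1 - 2 * i)"
    and "uw = 2 * (int p * (2 * m + 1) - int p * i - w * j)"
    and "vw = 2 * (int p * (2 * m + 1) + int p * (2 * n + 1) - int p * i - w * j')"
  have parity: "odd w" "odd tw" "even uw" "even vw"
    using pq(3) by (simp_all add: w_def tw_def uw_def vw_def)
  have P_mult: "P * of_int w = 2 * real p"
    using pq by (simp add: PP_def w_def)
  have "of_int tw = P * of_int w * (2 * of_int m + 1) + of_int w * (2 * of_int n + 1 - 2 * of_int i)"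
    "of_int uw = P * of_int w * (2 * of_int m + 1) - P * of_int w * of_int i - 2 * of_int w * of_int j"
    "of_int vw = P * of_int w * (2 * of_int m + 1) + P * of_int w * (2 * of_int n + 1)
      - P * of_int w * of_int i - 2 * of_int w * of_int j'"
    unfolding P_mult tw_def uw_def vw_def by (simp_all add: algebra_simps)
  hence scale: "t * of_int w = of_int tw" "u * of_int w = of_int uw" "v * of_int w = of_int vw"
    unfolding t_eq u_eq v_eq by (simp_all add: algebra_simps)
  have off: "off_lattice P x" if "x * of_int w = of_int c" "odd c" for x c
    using off_lattice_odd[of x c] that by (simp add: w_def)
  have off_all: "off_lattice P (u - t)" "off_lattice P (v - t)" "off_lattice P (u - 1)"
    "off_lattice P (v - 1)" "off_lattice P (v - u - 1)"
    by (rule off[of _ "uw - tw"] off[of _ "vw - tw"] off[of _ "uw - w"] off[of _ "vw - w"]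
          off[of _ "vw - uw - w"]; use parity in \<open>simp add: scale left_diff_distrib\<close>)+
  have "u \<noteq> 1" "u \<noteq> -1" "v \<noteq> 1" "v \<noteq> -1"
    using off_lattice_small(1,3)[OF off_all(3)] off_lattice_small(1,3)[OF off_all(4)] by auto
  thus "fiber_point P t u v"
    using off_all range P_bounds by unfold_locales auto
qed

text \<open>Moving up one square raises the first coordinate by 2, so \<open>i\<close> grows by 1
  and \<open>t\<close> is unchanged.\<close>

lemma t_North: "P * (2 * of_int m + 1) + (2 * of_int (n + 1) + 1) = 2 * of_int (i + 1) + t"
  using t by simp

text \<open>Expanded so that the products of \<open>P\<close> with \<open>m\<close>,
  \<open>n\<close> and \<open>i\<close> act as atoms for \<open>linarith\<close>.\<close>

lemma linear_relations:
  "t = 2 * (P * of_int m) + P + 2 * of_int n + 1 - 2 * of_int i"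
  "u = 2 * (P * of_int m) + P - P * of_int i - 2 * of_int j"
  "v = 2 * (P * of_int m) + 2 * (P * of_int n) + 2 * P - P * of_int i - 2 * of_int j'"
  using t_eq u_eq v_eq by (simp_all add: algebra_simps)

text \<open>The witnesses come from \<open>P * i + 1 = t - u + 2 * (i - n - j)\<close>,
  \<open>P * (M - i) + 1 = v - P + 1 + 2 * j'\<close>,
  \<open>2 * P * n = v - u - P + 2 * (j' - j)\<close> and
  \<open>2 * P * m = t + 1 - P + 2 * (i - n - 1)\<close>. A shift of an intercept by 1 adds
  \<open>P\<close>; passing to the north or east edge adds \<open>2 * P\<close> to the edge
  value.\<close>

lemma good_lit_regime1:
  assumes "-1 \<le> t" "t \<le> -1 + P"
  shows "good p q m n North \<longleftrightarrow>
      lit (wrap (t - u)) (wrap (v - u + P)) \<noteq> lit (wrap (v + P + 1)) (wrap (v - u + P))"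
    and "good p q m n South \<longleftrightarrow>
      lit (wrap (t - u - P)) (wrap (v - u - P)) \<noteq> lit (wrap (v + 1)) (wrap (v - u - P))"
    and "good p q m n East \<longleftrightarrow>
      lit (wrap (t - u)) (wrap (t + 1 + P)) \<noteq> lit (wrap (v + P + 1)) (wrap (t + 1 + P))"
    and "good p q m n West \<longleftrightarrow>
      lit (wrap (t - u - P)) (wrap (t + 1 - P)) \<noteq> lit (wrap (v + 1)) (wrap (t + 1 - P))"
proof -
  show "good p q m n North \<longleftrightarrow>
      lit (wrap (t - u)) (wrap (v - u + P)) \<noteq> lit (wrap (v + P + 1)) (wrap (v - u + P))"
    by (rule good_wrap[OF good_South_regime1[OF t_North assms, folded good_North], of _ "i - n - j" _ "j'" _ "j' - j"])
      (unfold of_int_add of_int_diff of_int_mult of_int_numeral of_int_1 distrib_left right_diff_distrib,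
        (use assms P u v linear_relations in linarith)+)
  show "good p q m n South \<longleftrightarrow>
      lit (wrap (t - u - P)) (wrap (v - u - P)) \<noteq> lit (wrap (v + 1)) (wrap (v - u - P))"
    by (rule good_wrap[OF good_South_regime1[OF t assms], of _ "i - n - j" _ "j'" _ "j' - j"])
      (unfold of_int_add of_int_diff of_int_mult of_int_numeral of_int_1 distrib_left right_diff_distrib,
        (use assms P u v linear_relations in linarith)+)
  \<comment> \<open>The P-line meeting the east edge has intercept \<open>i\<close> as long as
    \<open>t \<le> 1 - P\<close>, and \<open>i + 1\<close> from there on.\<close>
  show "good p q m n East \<longleftrightarrow>
      lit (wrap (t - u)) (wrap (t + 1 + P)) \<noteq> lit (wrap (v + P + 1)) (wrap (t + 1 + P))"
    by (rule good_wrap[OF good_West_iff[of n "m + 1" "i", folded good_East], of _ "i - n - j" _ "j'" _ "i - n - 1"])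
      (unfold of_int_add of_int_diff of_int_mult of_int_numeral of_int_1 distrib_left right_diff_distrib,
        (use assms P u v linear_relations in linarith)+)
  \<comment> \<open>The P-line meeting the west edge has intercept \<open>i - 1\<close> up to
    \<open>t = -1 + P\<close>, and \<open>i\<close> from there on.\<close>
  show "good p q m n West \<longleftrightarrow>
      lit (wrap (t - u - P)) (wrap (t + 1 - P)) \<noteq> lit (wrap (v + 1)) (wrap (t + 1 - P))"
    by (rule good_wrap[OF good_West_iff[of n m "i - 1"], of _ "i - n - j" _ "j'" _ "i - n - 1"])
      (unfold of_int_add of_int_diff of_int_mult of_int_numeral of_int_1 distrib_left right_diff_distrib,
        (use assms P u v linear_relations in linarith)+)
qed

lemma good_lit_regime2:
  assumes "-1 + P \<le> t" "t \<le> 1 - P"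
  shows "good p q m n North \<longleftrightarrow>
      lit (wrap (v + 1)) (wrap (v - u + P)) \<noteq> lit (wrap (v + P + 1)) (wrap (v - u + P))"
    and "good p q m n South \<longleftrightarrow>
      lit (wrap (v - P + 1)) (wrap (v - u - P)) \<noteq> lit (wrap (v + 1)) (wrap (v - u - P))"
    and "good p q m n East \<longleftrightarrow>
      lit (wrap (t - u)) (wrap (t + 1 + P)) \<noteq> lit (wrap (v + P + 1)) (wrap (t + 1 + P))"
    and "good p q m n West \<longleftrightarrow>
      lit (wrap (t - u)) (wrap (t + 1 - P)) \<noteq> lit (wrap (v - P + 1)) (wrap (t + 1 - P))"
proof -
  show "good p q m n North \<longleftrightarrow>
      lit (wrap (v + 1)) (wrap (v - u + P)) \<noteq> lit (wrap (v + P + 1)) (wrap (v - u + P))"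
    by (rule good_wrap[OF good_South_regime2[OF t_North assms, folded good_North], of _ "j'" _ "j'" _ "j' - j"])
      (unfold of_int_add of_int_diff of_int_mult of_int_numeral of_int_1 distrib_left right_diff_distrib,
        (use assms P u v linear_relations in linarith)+)
  show "good p q m n South \<longleftrightarrow>
      lit (wrap (v - P + 1)) (wrap (v - u - P)) \<noteq> lit (wrap (v + 1)) (wrap (v - u - P))"
    by (rule good_wrap[OF good_South_regime2[OF t assms], of _ "j'" _ "j'" _ "j' - j"])
      (unfold of_int_add of_int_diff of_int_mult of_int_numeral of_int_1 distrib_left right_diff_distrib,
        (use assms P u v linear_relations in linarith)+)
  show "good p q m n East \<longleftrightarrow>
      lit (wrap (t - u)) (wrap (t + 1 + P)) \<noteq> lit (wrap (v + P + 1)) (wrap (t + 1 + P))"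
    by (rule good_wrap[OF good_West_iff[of n "m + 1" "i", folded good_East], of _ "i - n - j" _ "j'" _ "i - n - 1"])
      (unfold of_int_add of_int_diff of_int_mult of_int_numeral of_int_1 distrib_left right_diff_distrib,
        (use assms P u v linear_relations in linarith)+)
  show "good p q m n West \<longleftrightarrow>
      lit (wrap (t - u)) (wrap (t + 1 - P)) \<noteq> lit (wrap (v - P + 1)) (wrap (t + 1 - P))"
    by (rule good_wrap[OF good_West_iff[of n m "i"], of _ "i - n - j" _ "j'" _ "i - n - 1"])
      (unfold of_int_add of_int_diff of_int_mult of_int_numeral of_int_1 distrib_left right_diff_distrib,
        (use assms P u v linear_relations in linarith)+)
qed

lemma good_lit_regime3:
  assumes "1 - P \<le> t" "t \<le> 1"
  shows "good p q m n North \<longleftrightarrow>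
      lit (wrap (t - u + P)) (wrap (v - u + P)) \<noteq> lit (wrap (v + 1)) (wrap (v - u + P))"
    and "good p q m n South \<longleftrightarrow>
      lit (wrap (t - u)) (wrap (v - u - P)) \<noteq> lit (wrap (v - P + 1)) (wrap (v - u - P))"
    and "good p q m n East \<longleftrightarrow>
      lit (wrap (t - u + P)) (wrap (t + 1 + P)) \<noteq> lit (wrap (v + 1)) (wrap (t + 1 + P))"
    and "good p q m n West \<longleftrightarrow>
      lit (wrap (t - u)) (wrap (t + 1 - P)) \<noteq> lit (wrap (v - P + 1)) (wrap (t + 1 - P))"
proof -
  show "good p q m n North \<longleftrightarrow>
      lit (wrap (t - u + P)) (wrap (v - u + P)) \<noteq> lit (wrap (v + 1)) (wrap (v - u + P))"
    by (rule good_wrap[OF good_South_regime3[OF t_North assms, folded good_North], of _ "i - n - j" _ "j'" _ "j' - j"])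
      (unfold of_int_add of_int_diff of_int_mult of_int_numeral of_int_1 distrib_left right_diff_distrib,
        (use assms P u v linear_relations in linarith)+)
  show "good p q m n South \<longleftrightarrow>
      lit (wrap (t - u)) (wrap (v - u - P)) \<noteq> lit (wrap (v - P + 1)) (wrap (v - u - P))"
    by (rule good_wrap[OF good_South_regime3[OF t assms], of _ "i - n - j" _ "j'" _ "j' - j"])
      (unfold of_int_add of_int_diff of_int_mult of_int_numeral of_int_1 distrib_left right_diff_distrib,
        (use assms P u v linear_relations in linarith)+)
  show "good p q m n East \<longleftrightarrow>
      lit (wrap (t - u + P)) (wrap (t + 1 + P)) \<noteq> lit (wrap (v + 1)) (wrap (t + 1 + P))"
    by (rule good_wrap[OF good_West_iff[of n "m + 1" "i + 1", folded good_East], of _ "i - n - j" _ "j'" _ "i - n - 1"])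
      (unfold of_int_add of_int_diff of_int_mult of_int_numeral of_int_1 distrib_left right_diff_distrib,
        (use assms P u v linear_relations in linarith)+)
  show "good p q m n West \<longleftrightarrow>
      lit (wrap (t - u)) (wrap (t + 1 - P)) \<noteq> lit (wrap (v - P + 1)) (wrap (t + 1 - P))"
    by (rule good_wrap[OF good_West_iff[of n m "i"], of _ "i - n - j" _ "j'" _ "i - n - 1"])
      (unfold of_int_add of_int_diff of_int_mult of_int_numeral of_int_1 distrib_left right_diff_distrib,
        (use assms P u v linear_relations in linarith)+)
qed

text \<open>The two exclusive ors meet here: one of two candidates being light, and one of column
  and row being that of the letter.\<close>

lemma good_iff_cell:
  assumes "regime P t k" and "spos k e = (c, r)"
  shows "good p q m n e \<longleftrightarrow> (cuts P t k ! (c - 1) \<le> u \<and> u \<le> cuts P t k ! c) \<noteq>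
    (cuts P t k ! (r - 1) \<le> v \<and> v \<le> cuts P t k ! r)"
proof -
  consider "k = 1" "-1 \<le> t" "t \<le> -1 + P" | "k = 2" "-1 + P \<le> t" "t \<le> 1 - P" | "k = 3" "1 - P \<le> t" "t \<le> 1"
    using assms(1) unfolding regime_def by blast
  thus ?thesis
  proof cases
    case 1
    show ?thesis
      using assms(2) good_lit_regime1[OF 1(2,3)] lit_regime1[OF 1(2,3)] 1(1)
      by (cases e) (auto simp: spos_def cuts_def)
  next
    case 2
    show ?thesis
      using assms(2) good_lit_regime2[OF 2(2,3)] lit_regime2[OF 2(2,3)] 2(1)
      by (cases e) (auto simp: spos_def cuts_def)
  next
    case 3
    show ?thesis
      using assms(2) good_lit_regime3[OF 3(2,3)] lit_regime3[OF 3(2,3)] 3(1)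
      by (cases e) (auto simp: spos_def cuts_def)
  qed
qed

text \<open>Every cut differs from \<open>t\<close> or from 1 by an integer combination of
  \<open>P\<close> and 2.\<close>

lemma cuts_avoid:
  assumes "regime P t k"
  shows "u \<notin> set (cuts P t k)" "v \<notin> set (cuts P t k)"
  using assms generic unfolding regime_def by (auto simp: cuts_def)

text \<open>Quantifying over all admissible \<open>k\<close>, \<open>a\<close>, \<open>b\<close>
  covers a \<open>t\<close> shared by two regimes: both descriptions then yield the same
  label.\<close>

lemma rect_label_eq_grid_light_set:
  assumes "regime P t k" "a \<in> {1..4}" "b \<in> {1..4}"
    and "cuts P t k ! (a - 1) \<le> u" "u \<le> cuts P t k ! a"
    and "cuts P t k ! (b - 1) \<le> v" "v \<le> cuts P t k ! b"
  shows "rect_label k a b = grid_light_set p q m n"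
proof -
  let ?cs = "cuts P t k"
  have sorted: "sorted ?cs" and len: "length ?cs = 5"
    using assms(1) P unfolding regime_def by (auto simp: cuts_def)
  have "e \<in> rect_label k a b \<longleftrightarrow> good p q m n e" for e
  proof -
    obtain c r where cr: "spos k e = (c, r)" by fastforce
    have rng: "c \<in> {1..4}" "r \<in> {1..4}"
      using spos_range[of k e] cr by simp_all
    have "c = a \<longleftrightarrow> ?cs ! (c - 1) \<le> u \<and> u \<le> ?cs ! c" "r = b \<longleftrightarrow> ?cs ! (r - 1) \<le> v \<and> v \<le> ?cs ! r"
      using assms rng by (intro sorted_cell_unique[OF sorted] cuts_avoid; simp add: len)+
    thus ?thesis
      unfolding rect_label_iff good_iff_cell[OF assms(1) cr] by (simp add: cr)
  qed
  thus ?thesis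
    by (auto simp: grid_light_set_def)
qed

end


section \<open>Topology of the pieces\<close>

lemma cuts_ends: "cuts P T k ! 0 = -1" "cuts P T k ! 4 = 1"
  by (auto simp: cuts_def)

lemma cuts_sorted:
  assumes "0 < P" "P < 1" "regime P T k"
  shows "sorted (cuts P T k)"
  using assms unfolding regime_def by (auto simp: cuts_def)

lemma cell_within_unit:
  assumes "0 < P" "P < 1" "regime P T k" "a \<in> {1..4}"
    and "cuts P T k ! (a - 1) \<le> x" "x \<le> cuts P T k ! a"
  shows "-1 \<le> x" "x \<le> 1"
proof -
  have len: "length (cuts P T k) = 5"
    by (simp add: cuts_def)
  note mono = sorted_nth_mono[OF cuts_sorted[OF assms(1-3)]]
  have "cuts P T k ! 0 \<le> cuts P T k ! (a - 1)" "cuts P T k ! a \<le> cuts P T k ! 4"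
    using assms(4) by (auto intro!: mono simp: len)
  thus "-1 \<le> x" "x \<le> 1"
    using assms(5,6) unfolding cuts_ends by linarith+
qed

lemma cuts_cover:
  assumes "-1 \<le> x" "x \<le> 1"
  shows "\<exists>a\<in>{1..4}. cuts P T k ! (a - 1) \<le> x \<and> x \<le> cuts P T k ! a"
proof -
  consider "x \<le> cuts P T k ! 1" | "cuts P T k ! 1 \<le> x" "x \<le> cuts P T k ! 2"
    | "cuts P T k ! 2 \<le> x" "x \<le> cuts P T k ! 3" | "cuts P T k ! 3 \<le> x"
    by linarith
  thus ?thesis
  proof cases
    case 1 with assms cuts_ends show ?thesis by (intro bexI[of _ 1]) auto
  next
    case 2 thus ?thesis by (intro bexI[of _ 2]) auto
  next
    case 3 thus ?thesis by (intro bexI[of _ 3]) auto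
  next
    case 4 with assms cuts_ends show ?thesis by (intro bexI[of _ 4]) auto
  qed
qed

lemma continuous_on_cuts:
  assumes "i \<le> 4"
  shows "continuous_on S (\<lambda>z. cuts P (fst z) k ! i)"
proof -
  have "i = 0 \<or> i = 1 \<or> i = 2 \<or> i = 3 \<or> i = 4" using assms by linarith
  thus ?thesis
    by (cases "k = 1"; cases "k = 2")
      (auto simp: cuts_def numeral_eq_Suc intro!: continuous_intros)
qed

text \<open>A finite union of cells, each cut out by weak inequalities between continuous
  functions.\<close>

lemma closed_fund_piece: "closed (fund_piece P L)"
proof -
  define cell where "cell k a b = {z. regime P (fst z) k \<and>
      cuts P (fst z) k ! (a - 1) \<le> fst (snd z) \<and> fst (snd z) \<le> cuts P (fst z) k ! a \<and>
      cuts P (fst z) k ! (b - 1) \<le> snd (snd z) \<and> snd (snd z) \<le> cuts P (fst z) k ! b}" for k a b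
  have eq: "fund_piece P L =
      (\<Union>k\<in>{1, 2, 3}. \<Union>a\<in>{1..4}. \<Union>b\<in>{b \<in> {1..4}. rect_label k a b = L}. cell k a b)"
    (is "_ = ?R")
  proof (rule set_eqI)
    fix z :: "real \<times> real \<times> real"
    obtain T U1 U2 where z: "z = (T, U1, U2)" by (cases z)
    have "k \<in> {1, 2, 3}" if "regime P T k" for k
      using that unfolding regime_def by blast
    thus "z \<in> fund_piece P L \<longleftrightarrow> z \<in> ?R"
      unfolding z fund_piece_def cell_def UN_iff mem_Collect_eq prod.case fst_conv snd_conv by blast
  qed
  have closed_cell: "closed (cell k a b)" if "a \<in> {1..4}" "b \<in> {1..4}" for k a b
  proof -
    have ge: "closed {z :: real \<times> real \<times> real. cuts P (fst z) k ! i \<le> f z}"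
      and le: "closed {z :: real \<times> real \<times> real. f z \<le> cuts P (fst z) k ! i}"
      if "i \<le> 4" "continuous_on UNIV f" for i f
      by (rule closed_Collect_le[OF continuous_on_cuts[OF that(1)] that(2)]
          closed_Collect_le[OF that(2) continuous_on_cuts[OF that(1)]])+
    have fs: "continuous_on UNIV (\<lambda>z :: real \<times> real \<times> real. fst (snd z))"
      and ss: "continuous_on UNIV (\<lambda>z :: real \<times> real \<times> real. snd (snd z))"
      by (intro continuous_intros)+
    have "{T :: real. regime P T k} =
        (if k = 1 then {-1..-1 + P} else if k = 2 then {-1 + P..1 - P} else if k = 3 then {1 - P..1} else {})"
      by (auto simp: regime_def)
    hence "closed {T. regime P T k}"
      by simp
    hence "closed (fst -` {T. regime P T k} :: (real \<times> real \<times> real) set)"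
      by (rule closed_vimage_fst)
    hence regime: "closed {z :: real \<times> real \<times> real. regime P (fst z) k}"
      by (simp add: vimage_def)
    have ab: "a - 1 \<le> 4" "a \<le> 4" "b - 1 \<le> 4" "b \<le> 4"
      using that by auto
    show ?thesis
      unfolding cell_def
      by (rule closed_Collect_conj regime ge[OF ab(1) fs] le[OF ab(2) fs] ge[OF ab(3) ss] le[OF ab(4) ss])+
  qed
  show ?thesis
    unfolding eq by (intro closed_UN ballI closed_cell) simp_all
qed

lemma compact_fund_piece:
  assumes "0 < P" "P < 1"
  shows "compact (fund_piece P L)"
proof -
  have "fund_piece P L \<subseteq> {-1..1} \<times> {-1..1} \<times> {-1..1}"
  proof
    fix z assume "z \<in> fund_piece P L"
    then obtain T U1 U2 k a b where z: "z = (T, U1, U2)" and k: "regime P T k"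
      and ab: "a \<in> {1..4}" "b \<in> {1..4}"
      and le: "cuts P T k ! (a - 1) \<le> U1" "U1 \<le> cuts P T k ! a"
        "cuts P T k ! (b - 1) \<le> U2" "U2 \<le> cuts P T k ! b"
      unfolding fund_piece_def by blast
    have "-1 \<le> T" "T \<le> 1"
      using k assms unfolding regime_def by auto
    moreover have "-1 \<le> U1" "U1 \<le> 1" "-1 \<le> U2" "U2 \<le> 1"
      using cell_within_unit[OF assms k ab(1) le(1,2)] cell_within_unit[OF assms k ab(2) le(3,4)]
      by simp_all
    ultimately show "z \<in> {-1..1} \<times> {-1..1} \<times> {-1..1}"
      by (simp add: z)
  qed
  moreover have "compact ({-1..1::real} \<times> {-1..1::real} \<times> {-1..1::real})"
    by (intro compact_Times compact_Icc)
  ultimately show ?thesis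
    using closed_fund_piece compact_Int_closed by (metis Int_absorb1)
qed

text \<open>The lattice \<open>Lambda_P\<close> itself, as a set to which the fundamental pieces are
  added.\<close>

definition tile_lattice :: "real \<Rightarrow> (real \<times> real \<times> real) set" where
  "tile_lattice P = {(2 * of_int i, P * of_int i + 2 * of_int j, P * of_int i + 2 * of_int k) | i j k. True}"

text \<open>Lattice points are those whose three coordinates in the lattice basis are integers, and
  these coordinates are continuous.\<close>

lemma closed_tile_lattice: "closed (tile_lattice P)"
proof -
  have eq: "tile_lattice P = {z. fst z / 2 \<in> \<int> \<and> (fst (snd z) - P * (fst z / 2)) / 2 \<in> \<int> \<and>
      (snd (snd z) - P * (fst z / 2)) / 2 \<in> \<int>}" (is "_ = ?R")
  proof (intro subset_antisym subsetI)
    fix z assume "z \<in> ?R"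
    then obtain i j k where "fst z / 2 = of_int i" "(fst (snd z) - P * (fst z / 2)) / 2 = of_int j"
      "(snd (snd z) - P * (fst z / 2)) / 2 = of_int k"
      by (auto elim!: Ints_cases)
    hence "z = (2 * of_int i, P * of_int i + 2 * of_int j, P * of_int i + 2 * of_int k)"
      by (auto simp: prod_eq_iff)
    thus "z \<in> tile_lattice P"
      unfolding tile_lattice_def by blast
  qed (auto simp: tile_lattice_def)
  have "closed {z. f z \<in> \<int>}" if "continuous_on UNIV f" for f :: "real \<times> real \<times> real \<Rightarrow> real"
    using closed_vimage[OF closed_Ints that] by (simp add: vimage_def)
  note Ints = this
  have "closed ?R"
    by (intro closed_Collect_conj Ints continuous_intros) simp_all
  with eq show ?thesis by simp
qed

text \<open>A piece is the Minkowski sum of a compact set and the closed lattice, hence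
  closed.\<close>

lemma closed_piece:
  assumes "0 < P" "P < 1"
  shows "closed (piece P L)"
proof -
  have "piece P L = (\<Union>x\<in>fund_piece P L. \<Union>y\<in>tile_lattice P. {x + y})"
  proof (intro subset_antisym subsetI)
    fix z assume "z \<in> piece P L"
    then obtain T U1 U2 i j k where z: "z = (T, U1, U2)" and
      "(T - 2 * of_int i, U1 - (P * of_int i + 2 * of_int j), U2 - (P * of_int i + 2 * of_int k)) \<in> fund_piece P L"
      (is "?x \<in> _")
      unfolding piece_def by blast
    moreover have "(2 * of_int i, P * of_int i + 2 * of_int j, P * of_int i + 2 * of_int k) \<in> tile_lattice P"
      (is "?y \<in> _")
      unfolding tile_lattice_def by blast
    moreover have "z = ?x + ?y"
      by (simp add: z)
    ultimately show "z \<in> (\<Union>x\<in>fund_piece P L. \<Union>y\<in>tile_lattice P. {x + y})"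
      by blast
  next
    fix z assume "z \<in> (\<Union>x\<in>fund_piece P L. \<Union>y\<in>tile_lattice P. {x + y})"
    then obtain x i j k where "x \<in> fund_piece P L"
      "z = x + (2 * of_int i, P * of_int i + 2 * of_int j, P * of_int i + 2 * of_int k)"
      unfolding tile_lattice_def by blast
    hence "(fst z - 2 * of_int i, fst (snd z) - (P * of_int i + 2 * of_int j),
        snd (snd z) - (P * of_int i + 2 * of_int k)) \<in> fund_piece P L"
      by (cases x) simp
    thus "z \<in> piece P L"
      unfolding piece_def by (cases z) auto
  qed
  thus ?thesis
    using compact_closed_sums[OF compact_fund_piece[OF assms] closed_tile_lattice] by simp
qed

lemma ex_shift_into_unit: "\<exists>j::int. -1 \<le> x - (c + 2 * of_int j) \<and> x - (c + 2 * of_int j) \<le> (1::real)"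
proof
  define j where "j = \<lfloor>(x - c + 1) / 2\<rfloor>"
  have "of_int j \<le> (x - c + 1) / 2" "(x - c + 1) / 2 < of_int j + 1"
    unfolding j_def by linarith+
  thus "-1 \<le> x - (c + 2 * of_int j) \<and> x - (c + 2 * of_int j) \<le> 1"
    by (simp add: field_simps)
qed

lemma pieces_cover: "\<exists>L. z \<in> piece P L"
proof -
  obtain T U1 U2 where z: "z = (T, U1, U2)" by (cases z)
  obtain i :: int where "-1 \<le> T - (0 + 2 * of_int i)" "T - (0 + 2 * of_int i) \<le> 1"
    using ex_shift_into_unit by blast
  hence i: "-1 \<le> T - 2 * of_int i" "T - 2 * of_int i \<le> 1" by simp_all
  obtain j :: int where j: "-1 \<le> U1 - (P * of_int i + 2 * of_int j)" "U1 - (P * of_int i + 2 * of_int j) \<le> 1"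
    using ex_shift_into_unit by blast
  obtain j' :: int where j': "-1 \<le> U2 - (P * of_int i + 2 * of_int j')" "U2 - (P * of_int i + 2 * of_int j') \<le> 1"
    using ex_shift_into_unit by blast
  have "\<exists>k. regime P t k" if "-1 \<le> t" "t \<le> 1" for t
    using that unfolding regime_def by (metis linorder_le_cases)
  with i obtain k where k: "regime P (T - 2 * of_int i) k"
    by blast
  show ?thesis
  proof -
    let ?t = "T - 2 * of_int i"
    obtain a where a: "a \<in> {1..4}" "cuts P ?t k ! (a - 1) \<le> U1 - (P * of_int i + 2 * of_int j)"
      "U1 - (P * of_int i + 2 * of_int j) \<le> cuts P ?t k ! a"
      using cuts_cover[OF j, of P ?t k] by blast
    obtain b where b: "b \<in> {1..4}" "cuts P ?t k ! (b - 1) \<le> U2 - (P * of_int i + 2 * of_int j')"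
      "U2 - (P * of_int i + 2 * of_int j') \<le> cuts P ?t k ! b"
      using cuts_cover[OF j', of P ?t k] by blast
    have "(?t, U1 - (P * of_int i + 2 * of_int j), U2 - (P * of_int i + 2 * of_int j')) \<in>
        fund_piece P (rect_label k a b)"
      unfolding fund_piece_def mem_Collect_eq prod.case using k a b by blast
    thus ?thesis
      unfolding z piece_def mem_Collect_eq prod.case by blast
  qed
qed

lemma finite_edge_sets: "finite (UNIV :: edge set set)"
proof -
  have "finite (UNIV :: edge set)"
    by (rule finite_subset[of _ "{North, South, East, West}"]) (auto intro: edge.exhaust)
  thus ?thesis
    by (simp add: Finite_Set.finite_set)
qed

text \<open>The complement of the other pieces is open, as these are closed and finite in number;
  since all pieces cover space, it lies inside \<open>piece P G\<close>.\<close>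

lemma interior_piece_of_unique:
  assumes "0 < P" "P < 1" and unique: "\<And>L. z \<in> piece P L \<Longrightarrow> L = G"
  shows "z \<in> interior (piece P G)"
proof (rule interiorI)
  have "closed (\<Union>L\<in>-{G}. piece P L)"
    using finite_subset[OF subset_UNIV finite_edge_sets] closed_piece[OF assms(1,2)]
    by (intro closed_UN) auto
  thus "open (- (\<Union>L\<in>-{G}. piece P L))"
    by (rule open_Compl)
  show "z \<in> - (\<Union>L\<in>-{G}. piece P L)"
    using unique by blast
  show "- (\<Union>L\<in>-{G}. piece P L) \<subseteq> piece P G"
  proof
    fix y assume y: "y \<in> - (\<Union>L\<in>-{G}. piece P L)"
    obtain L where "y \<in> piece P L"
      using pieces_cover[of y P] ..
    with y show "y \<in> piece P G"
      by (cases "L = G") auto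
  qed
qed

section \<open>The piece containing the center of a square\<close>

lemma (in even_rational) piece_Xi_unique:
  assumes "Xi P (of_int m + 1/2, of_int n + 1/2) \<in> piece P L"
  shows "L = grid_light_set p q m n"
proof -
  let ?T = "2 * P * (of_int m + 1/2) + 2 * (of_int n + 1/2)" and ?U = "2 * P * (of_int m + 1/2)"
    and ?V = "2 * P * (of_int m + 1/2) + 2 * P * (of_int n + 1/2)"
  obtain i j j' :: int where mem: "(?T - 2 * of_int i, ?U - (P * of_int i + 2 * of_int j),
      ?V - (P * of_int i + 2 * of_int j')) \<in> fund_piece P L"
    using assms unfolding Xi_def piece_def by auto
  define t u v where "t = ?T - 2 * of_int i" and "u = ?U - (P * of_int i + 2 * of_int j)"
    and "v = ?V - (P * of_int i + 2 * of_int j')"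
  \<comment> \<open>Representative, regime and rectangle are whatever witnesses the membership; any
    choice leads to the same label.\<close>
  from mem obtain k a b where k: "regime P t k" and ab: "a \<in> {1..4}" "b \<in> {1..4}"
    and le: "cuts P t k ! (a - 1) \<le> u" "u \<le> cuts P t k ! a" "cuts P t k ! (b - 1) \<le> v" "v \<le> cuts P t k ! b"
    and L: "rect_label k a b = L"
    unfolding t_def[symmetric] u_def[symmetric] v_def[symmetric] fund_piece_def by blast
  interpret plaid_fiber p q m n i j j' t u v
  proof
    show "-1 \<le> u" "u \<le> 1" "-1 \<le> v" "v \<le> 1"
      using cell_within_unit[OF P_bounds k ab(1) le(1,2)] cell_within_unit[OF P_bounds k ab(2) le(3,4)]
      by simp_all
  qed (simp_all add: t_def u_def v_def algebra_simps)
  show ?thesis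
    using rect_label_eq_grid_light_set[OF k ab le] L by simp
qed

theorem theorem3p3:
  fixes p q :: nat and m n :: int
  assumes "even_rat_param p q"
  shows "grid_light_set p q m n = tile_light_set p q m n"
proof -
  interpret even_rational p q
    using assms by unfold_locales
  show ?thesis
    unfolding tile_light_set_def
  \<comment> \<open>Existence needs the interior, while uniqueness already follows from membership
    in the piece.\<close>
  proof (rule the_equality[symmetric])
    show "Xi P (of_int m + 1/2, of_int n + 1/2) \<in> interior (piece P (grid_light_set p q m n))"
      by (intro interior_piece_of_unique P_bounds piece_Xi_unique)
    show "L = grid_light_set p q m n" if "Xi P (of_int m + 1/2, of_int n + 1/2) \<in> interior (piece P L)" for L
      using that interior_subset piece_Xi_unique by blast
  qed
qed

end
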